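(* Let $\ell\ge 1$ be an integer and let $\alpha_s=\alpha_s^{(\ell,1)}(1,q)$ be defined by $\alpha_0=1$, $$\alpha_{3r}=q^{\frac32(\ell-3)r^2-\frac12(\ell-3)r}+q^{\frac32(\ell-3)r^2+\frac12(\ell-3)r}\quad(r\ge 1),$$ $$\alpha_{3r+1}=-q^{\frac32(\ell-3)r^2+\frac12(\ell-3)r}\quad(r\ge 0),\qquad \alpha_{3r-1}=-q^{\frac32(\ell-3)r^2-\frac12(\ell-3)r}\quad(r\ge 1).$$ Let $\beta_n=\beta_n^{(\ell,1)}(1,q)=\sum_{s=0}^n\frac{\alpha_s}{(q;q)_{n-s}(q;q)_{n+s}}$ for $n\ge 0$, and $\beta_{-1}=0$. Then $$\sum_{m=0}^\infty q^{9m^2}\left(q^{-6m+1}\beta_{3m-1}+\beta_{3m}+q^{6m+1}\beta_{3m+1}\right)=\frac{(q,q^{\ell+2},q^{\ell+3};q^{\ell+3})_\infty\,(q^{\ell+1},q^{\ell+5};q^{2\ell+6})_\infty}{(q;q)_\infty}.$$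
   Context: $q$ is a formal variable (rational functions of $q$ are expanded as Laurent series in $q$ at $0$); equivalently one may take $0<|q|<1$. Notation: $(a;q)_k=\prod_{j=0}^{k-1}(1-aq^j)$ for $k\ge 0$, $(a;q)_\infty=\prod_{j\ge 0}(1-aq^j)$, and $(a_1,\dots,a_t;q)_\infty=(a_1;q)_\infty\cdots(a_t;q)_\infty$. *)

theory Defs
  imports "HOL-Analysis.Analysis"
begin

text \<open>
  The variable \<open>q\<close> is a complex number with \<open>0 < norm q < 1\<close>, one of the two equivalent readings
  of identities between Laurent series in \<open>q\<close>. Integer exponents use \<open>powi\<close>, as they
  may be negative.
\<close>

definition qpoch :: "complex \<Rightarrow> complex \<Rightarrow> nat \<Rightarrow> complex" where
  "qpoch a q k = (\<Prod>j<k. 1 - a * q ^ j)"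

definition qpoch_inf :: "complex \<Rightarrow> complex \<Rightarrow> complex" where
  "qpoch_inf a q = prodinf (\<lambda>j. 1 - a * q ^ j)"

definition qpochs_inf :: "complex list \<Rightarrow> complex \<Rightarrow> complex" where
  "qpochs_inf as q = (\<Prod>a\<leftarrow>as. qpoch_inf a q)"

text \<open>
  The exponents \<open>3/2 (l-3) r\<^sup>2 \<plusminus> 1/2 (l-3) r\<close> are integers because \<open>3 r\<^sup>2 \<plusminus> r\<close> is even, so the
  integer divisions below are exact.
\<close>

definition alpha_exp_minus :: "nat \<Rightarrow> nat \<Rightarrow> int" where
  "alpha_exp_minus l r = (3 * (int l - 3) * (int r)^2 - (int l - 3) * int r) div 2"

definition alpha_exp_plus :: "nat \<Rightarrow> nat \<Rightarrow> int" where
  "alpha_exp_plus l r = (3 * (int l - 3) * (int r)^2 + (int l - 3) * int r) div 2"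

text \<open>
  \<open>alpha l q s\<close> is \<open>\<alpha>\<^sub>s\<close> with parameters \<open>(l,1)\<close> at \<open>(1,q)\<close>. The cases \<open>s = 3r\<close>, \<open>s = 3r + 1\<close>
  and \<open>s = 3r - 1\<close> are distinguished by \<open>s mod 3\<close>, where \<open>r = (s + 1) div 3\<close> in all of them.
\<close>

definition alpha :: "nat \<Rightarrow> complex \<Rightarrow> nat \<Rightarrow> complex" where
  "alpha l q s =
     (let r = (s + 1) div 3 in
      if s = 0 then 1
      else if s mod 3 = 0 then q powi alpha_exp_minus l r + q powi alpha_exp_plus l r
      else if s mod 3 = 1 then - (q powi alpha_exp_plus l r)
      else - (q powi alpha_exp_minus l r))"

lemma alpha_0: "alpha l q 0 = 1"
  by (simp add: alpha_def)

lemma alpha_3r: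
  assumes "r \<ge> 1"
  shows "alpha l q (3 * r) = q powi alpha_exp_minus l r + q powi alpha_exp_plus l r"
proof -
  have "(3 * r + 1) div 3 = r" "(3 * r) mod 3 = 0" "3 * r \<noteq> 0"
    using assms by simp_all
  then show ?thesis unfolding alpha_def Let_def by (simp only: if_False if_True simp_thms)
qed

lemma alpha_3r_plus_1: "alpha l q (3 * r + 1) = - (q powi alpha_exp_plus l r)"
proof -
  have "(3 * r + 1 + 1) div 3 = r" "(3 * r + 1) mod 3 = 1" by presburger+
  then show ?thesis by (simp only: alpha_def Let_def) simp
qed

lemma alpha_3r_minus_1:
  assumes "r \<ge> 1"
  shows "alpha l q (3 * r - 1) = - (q powi alpha_exp_minus l r)"
proof -
  obtain k where r: "r = Suc k" using assms by (cases r) auto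
  have s: "3 * r - 1 = 3 * k + 2" using r by simp
  have "(3 * k + 2 + 1) div 3 = r" "(3 * k + 2) mod 3 = 2" "3 * k + 2 \<noteq> 0"
    unfolding r by presburger+
  then show ?thesis unfolding s by (simp only: alpha_def Let_def) simp
qed

lemma alpha_exp_minus_exact:
  "real_of_int (alpha_exp_minus l r) = 3/2 * (real l - 3) * real r ^ 2 - 1/2 * (real l - 3) * real r"
proof -
  have "even (3 * (int l - 3) * (int r)^2 - (int l - 3) * int r)" by simp
  then have "2 * alpha_exp_minus l r = 3 * (int l - 3) * (int r)^2 - (int l - 3) * int r"
    unfolding alpha_exp_minus_def by (rule dvd_mult_div_cancel)
  from arg_cong[OF this, of real_of_int] show ?thesis by simp
qed

lemma alpha_exp_plus_exact:
  "real_of_int (alpha_exp_plus l r) = 3/2 * (real l - 3) * real r ^ 2 + 1/2 * (real l - 3) * real r"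
proof -
  have "even (3 * (int l - 3) * (int r)^2 + (int l - 3) * int r)" by simp
  then have "2 * alpha_exp_plus l r = 3 * (int l - 3) * (int r)^2 + (int l - 3) * int r"
    unfolding alpha_exp_plus_def by (rule dvd_mult_div_cancel)
  from arg_cong[OF this, of real_of_int] show ?thesis by simp
qed

text \<open>The index is an integer because \<open>\<beta>\<^sub>-\<^sub>1 = 0\<close> occurs in the sum (as \<open>\<beta>\<^bsub>3m-1\<^esub>\<close> for \<open>m = 0\<close>).\<close>

definition beta :: "nat \<Rightarrow> complex \<Rightarrow> int \<Rightarrow> complex" where
  "beta l q n =
     (if n < 0 then 0
      else (\<Sum>s\<le>nat n. alpha l q s / (qpoch q q (nat n - s) * qpoch q q (nat n + s))))"

end

(*
  The weights in the theorem are q^(n^2) for n = 3m - 1, 3m, 3m + 1, so its left-hand side is the sum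
  of q^(n^2) beta_n over all n, grouped in threes. By the limiting case of Bailey's lemma at a = 1,
  this is the sum of q^(s^2) alpha_s divided by (q;q)_inf; the input is Cauchy's identity
  sum_k q^(k^2 + a k) / ((q;q)_k (q;q)_{k+a}) = 1 / (q;q)_inf. Grouping again in threes turns the
  sum over alpha into the bilateral series of the quintuple product identity with base q^(l+3) at
  z = -q. The quintuple product itself is the limit of the finite form due to Chen, Chu and Gu.
*)

theory Submission
  imports Defs
begin

section \<open>q-Pochhammer symbols\<close>

text \<open>The weight \<open>q^(s^2)\<close> adds \<open>9 r^2\<close> to the leading exponent
  \<open>3/2 (l - 3) r^2\<close>, which is how \<open>l - 3\<close> becomes \<open>l + 3\<close>.
  For \<open>l = 1\<close> and \<open>l = 2\<close> the exponents of \<open>alpha\<close> tend to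
  minus infinity, so \<open>alpha\<close> is unbounded and only the weight makes its series
  converge. The interchange of summations is carried out on partial sums, where each inner Cauchy
  sum is truncated at a depth depending on \<open>s\<close>; both this limit and that of the finite
  quintuple identity are instances of Tannery's theorem with majorants built from bounded
  reciprocals of Pochhammer symbols. The finite identity has right-hand side 1 and follows from a
  Wilf-Zeilberger certificate, that is, from a rational function identity.\<close>

lemma qpoch_0 [simp]: "qpoch a q 0 = 1"
  by (simp add: qpoch_def)

lemma qpoch_Suc: "qpoch a q (Suc n) = qpoch a q n * (1 - a * q ^ n)"
  by (simp add: qpoch_def)

lemma qpoch_add: "qpoch a q (m + n) = qpoch a q m * qpoch (a * q ^ m) q n"
  by (induction n) (simp_all add: qpoch_Suc power_add mult.assoc)

lemma qpoch_Suc_left: "qpoch a q (Suc n) = (1 - a) * qpoch (a * q) q n"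
  using qpoch_add[of a q 1 n] by (simp add: qpoch_Suc)

lemma qpoch_nonzero: "(\<And>j. a * q ^ j \<noteq> 1) \<Longrightarrow> qpoch a q n \<noteq> 0"
  by (auto simp: qpoch_def)

lemma power_neq_1:
  fixes q :: complex
  assumes "norm q < 1" "n > 0"
  shows "q ^ n \<noteq> 1"
proof
  assume "q ^ n = 1"
  then have "norm q ^ n = 1" by (simp flip: norm_power)
  moreover have "norm q ^ n < 1"
    using assms by (simp add: power_less_one_iff)
  ultimately show False by simp
qed

lemma qpoch_self_nonzero: "norm q < 1 \<Longrightarrow> qpoch q q n \<noteq> 0"
  by (rule qpoch_nonzero) (metis power_Suc power_neq_1 zero_less_Suc)

lemma qpoch_convergent_prod:
  fixes a q :: complex
  assumes "norm q < 1"
  shows "convergent_prod (\<lambda>j. 1 - a * q ^ j)"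
proof -
  have "summable (\<lambda>j. norm (a * q ^ j))"
    using assms by (simp add: norm_mult norm_power summable_mult)
  then have "abs_convergent_prod (\<lambda>j. 1 - a * q ^ j)"
    by (simp add: abs_convergent_prod_conv_summable)
  then show ?thesis by (rule abs_convergent_prod_imp_convergent_prod)
qed

lemma qpoch_tendsto:
  assumes "norm q < 1"
  shows "qpoch a q \<longlonglongrightarrow> qpoch_inf a q"
proof -
  have "(\<lambda>n. qpoch a q (Suc n)) \<longlonglongrightarrow> qpoch_inf a q"
    using convergent_prod_LIMSEQ[OF qpoch_convergent_prod[OF assms, of a]]
    by (simp add: qpoch_def qpoch_inf_def lessThan_Suc_atMost)
  then show ?thesis by (rule LIMSEQ_imp_Suc)
qed

lemma qpoch_inf_nonzero:
  assumes "norm q < 1" "\<And>j. a * q ^ j \<noteq> 1"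
  shows "qpoch_inf a q \<noteq> 0"
  unfolding qpoch_inf_def
  by (rule prodinf_nonzero[OF qpoch_convergent_prod[OF assms(1)]])
     (metis assms(2) eq_iff_diff_eq_0)

lemma qpoch_inf_self_nonzero: "norm q < 1 \<Longrightarrow> qpoch_inf q q \<noteq> 0"
  by (rule qpoch_inf_nonzero) (simp, metis power_Suc power_neq_1 zero_less_Suc)

text \<open>A convergent sequence is bounded, and the limit of the reciprocals exists because the
  infinite product is nonzero. These bounds supply the constants in all majorants below.\<close>

lemma qpoch_inverse_bounded:
  assumes "norm q < 1" "\<And>j. a * q ^ j \<noteq> 1"
  shows "\<exists>M>0. \<forall>n. norm (inverse (qpoch a q n)) \<le> M"
proof -
  have "(\<lambda>n. inverse (qpoch a q n)) \<longlonglongrightarrow> inverse (qpoch_inf a q)"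
    by (intro tendsto_inverse qpoch_tendsto qpoch_inf_nonzero assms)
  then have "Bseq (\<lambda>n. inverse (qpoch a q n))"
    by (rule convergentI[THEN convergent_imp_Bseq])
  then show ?thesis by (auto simp: Bseq_def)
qed

lemma norm_qsquare_less_1: "norm (q :: complex) < 1 \<Longrightarrow> norm (q ^ 2) < 1"
  by (simp add: norm_power power_less_one_iff)

lemma qpoch_inf_even_odd:
  assumes "norm q < 1"
  shows "qpoch_inf a q = qpoch_inf a (q ^ 2) * qpoch_inf (a * q) (q ^ 2)"
proof -
  have "qpoch a q (2 * n) = qpoch a (q ^ 2) n * qpoch (a * q) (q ^ 2) n" for n
    by (induction n) (simp_all add: qpoch_Suc power_mult algebra_simps flip: power_mult)
  moreover have "(\<lambda>n. qpoch a q (2 * n)) \<longlonglongrightarrow> qpoch_inf a q"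
    using LIMSEQ_subseq_LIMSEQ[OF qpoch_tendsto[OF assms], of "\<lambda>n. 2 * n"]
    by (simp add: strict_mono_def comp_def)
  moreover have "(\<lambda>n. qpoch a (q ^ 2) n * qpoch (a * q) (q ^ 2) n)
      \<longlonglongrightarrow> qpoch_inf a (q ^ 2) * qpoch_inf (a * q) (q ^ 2)"
    by (intro tendsto_mult qpoch_tendsto norm_qsquare_less_1 assms)
  ultimately show ?thesis by (metis (no_types, lifting) LIMSEQ_unique ext)
qed

lemma qpoch_inf_square:
  assumes "norm q < 1"
  shows "qpoch_inf (a ^ 2) (q ^ 2) = qpoch_inf a q * qpoch_inf (- a) q"
proof -
  have "qpoch (a ^ 2) (q ^ 2) n = qpoch a q n * qpoch (- a) q n" for n
    by (induction n)
       (simp_all add: qpoch_Suc algebra_simps power2_eq_square power_mult_distrib)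
  moreover have "qpoch (a ^ 2) (q ^ 2) \<longlonglongrightarrow> qpoch_inf (a ^ 2) (q ^ 2)"
    by (intro qpoch_tendsto norm_qsquare_less_1 assms)
  moreover have "(\<lambda>n. qpoch a q n * qpoch (- a) q n) \<longlonglongrightarrow> qpoch_inf a q * qpoch_inf (- a) q"
    by (intro tendsto_mult qpoch_tendsto assms)
  ultimately show ?thesis by (metis (no_types, lifting) LIMSEQ_unique ext)
qed

text \<open>Both the length of the sum and its terms vary with \<open>n\<close>; extending the terms
  by zero beyond \<open>n\<close> gives series over a fixed index range, to which Tannery's theorem
  applies.\<close>

lemma tannery_partial_sums:
  fixes f :: "nat \<Rightarrow> nat \<Rightarrow> complex"
  assumes lim: "\<And>k. (\<lambda>n. f k n) \<longlonglongrightarrow> b k"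
    and bound: "\<And>k n. k < n \<Longrightarrow> norm (f k n) \<le> M k"
    and M: "summable M"
  shows "(\<lambda>n. \<Sum>k<n. f k n) \<longlonglongrightarrow> suminf b" and "summable b"
proof -
  define a where "a k n = (if k < n then f k n else 0)" for k n
  have M0: "0 \<le> M k" for k
    using bound[of k "Suc k"] norm_ge_zero order_trans by blast
  have a_lim: "(\<lambda>n. a k n) \<longlonglongrightarrow> b k" for k
    by (rule Lim_transform_eventually[OF lim])
       (auto simp: a_def eventually_sequentially intro!: exI[of _ "Suc k"])
  have "eventually (\<lambda>(k, n). norm (a k n) \<le> M k) (at_top \<times>\<^sub>F at_top)"
    by (rule always_eventually) (auto simp: a_def bound M0)
  from tannerys_theorem[OF a_lim this M]
  have *: "summable (\<lambda>n. norm (b n))" "(\<lambda>n. \<Sum>k. a k n) \<longlonglongrightarrow> suminf b"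
    by auto
  then show "summable b" by (simp add: summable_norm_cancel)
  have "(\<Sum>k. a k n) = (\<Sum>k<n. f k n)" for n
    by (subst suminf_finite[of "{..<n}"]) (auto simp: a_def)
  with *(2) show "(\<lambda>n. \<Sum>k<n. f k n) \<longlonglongrightarrow> suminf b" by simp
qed

section \<open>The limiting case of the Bailey lemma\<close>

definition cauchy_sum :: "complex \<Rightarrow> nat \<Rightarrow> nat \<Rightarrow> complex" where
  "cauchy_sum q a K = (\<Sum>k<K. q ^ (k ^ 2 + a * k) / (qpoch q q k * qpoch q q (k + a)))"

text \<open>The difference of the two summands at \<open>K\<close> is the forward difference of the
  right-hand side, which is 0 at \<open>K = 0\<close>. The right-hand side is a summand of the first
  series times a bounded factor, so it vanishes in the limit.\<close>

lemma cauchy_sum_telescope: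
  assumes "norm q < 1"
  shows "cauchy_sum q a K - cauchy_sum q (Suc a) K
    = - (q ^ (K ^ 2 + a * K) * (1 - q ^ K) / (qpoch q q K * qpoch q q (K + a)))"
proof (induction K)
  case 0
  show ?case by (simp add: cauchy_sum_def)
next
  case (Suc K)
  define u v X Y where "u = qpoch q q K" "v = qpoch q q (K + a)" "X = q ^ K" "Y = q ^ a"
  have nz: "u \<noteq> 0" "v \<noteq> 0" "1 - q * X \<noteq> 0" "1 - q * (X * Y) \<noteq> 0"
    using qpoch_self_nonzero[OF assms] power_neq_1[OF assms, of "Suc K"]
      power_neq_1[OF assms, of "Suc (K + a)"]
    by (auto simp: u_v_X_Y_def power_add)
  have eqs: "qpoch q q (Suc K) = u * (1 - q * X)" "qpoch q q (K + Suc a) = v * (1 - q * (X * Y))"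
     "qpoch q q (Suc K + a) = v * (1 - q * (X * Y))"
     "q ^ Suc K = q * X"
    by (simp_all add: u_v_X_Y_def qpoch_Suc power_add)
  define E where "E = q ^ (K ^ 2 + a * K)"
  have E: "q ^ (K ^ 2 + Suc a * K) = E * X" "q ^ (Suc K ^ 2 + a * Suc K) = E * (X ^ 2 * q * Y)"
    by (simp_all add: E_def u_v_X_Y_def power2_eq_square flip: power_add power_mult)
       (simp_all flip: power_add power_Suc power_Suc2 add: algebra_simps)
  have "cauchy_sum q a (Suc K) - cauchy_sum q (Suc a) (Suc K)
      = - (E * (1 - X) / (u * v)) + E / (u * v) - E * X / (u * (v * (1 - q * (X * Y))))"
    using Suc unfolding cauchy_sum_def sum.lessThan_Suc E eqs
    by (simp add: u_v_X_Y_def(1-3) flip: E_def u_v_X_Y_def(1-3))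
  also have "\<dots> = - (E * (X ^ 2 * q * Y) * (1 - q * X) / (u * (1 - q * X) * (v * (1 - q * (X * Y)))))"
    using nz by (simp add: divide_simps) (simp add: algebra_simps power2_eq_square)
  finally show ?case unfolding E eqs .
qed

lemma power_sq_le:
  fixes x :: real
  assumes "0 \<le> x" "x \<le> 1"
  shows "x ^ (k ^ 2 + a) \<le> x ^ k"
  by (rule power_decreasing) (use assms in \<open>auto simp: power2_eq_square intro: trans_le_add1\<close>)

lemma norm_cauchy_term_le:
  assumes q: "norm q < 1" and M: "0 < M" "\<And>n. norm (inverse (qpoch q q n)) \<le> M"
  shows "norm (q ^ (k ^ 2 + a * k) / (qpoch q q k * qpoch q q (k + a))) \<le> M ^ 2 * norm q ^ k"
proof -
  have "norm (q ^ (k ^ 2 + a * k) / (qpoch q q k * qpoch q q (k + a)))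
      = norm q ^ (k ^ 2 + a * k) * (norm (inverse (qpoch q q k)) * norm (inverse (qpoch q q (k + a))))"
    by (simp add: norm_divide norm_mult norm_power norm_inverse divide_inverse)
  also have "\<dots> \<le> norm q ^ k * (M * M)"
    using q M by (intro mult_mono power_sq_le) auto
  finally show ?thesis by (simp add: power2_eq_square mult.commute)
qed

lemma qpoch_self_inverse_bounded:
  assumes "norm q < 1"
  obtains M where "M > 0" "\<And>n. norm (inverse (qpoch q q n)) \<le> M"
  using qpoch_inverse_bounded[OF assms, of q] power_neq_1[OF assms]
  by (metis power_Suc zero_less_Suc)

text \<open>Uniformity in both arguments matters: \<open>bailey_limit\<close> uses the parameter
  \<open>2 * s\<close> and the truncation \<open>N - s\<close>, and takes this constant into its
  majorant.\<close>

lemma cauchy_sum_bounded: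
  assumes "norm q < 1"
  shows "\<exists>C. \<forall>a K. norm (cauchy_sum q a K) \<le> C"
proof -
  obtain M where M: "M > 0" "\<And>n. norm (inverse (qpoch q q n)) \<le> M"
    using qpoch_self_inverse_bounded[OF assms] by blast
  have "norm (cauchy_sum q a K) \<le> M ^ 2 * (1 / (1 - norm q))" for a K
  proof -
    have "norm (cauchy_sum q a K) \<le> (\<Sum>k<K. M ^ 2 * norm q ^ k)"
      unfolding cauchy_sum_def by (intro sum_norm_le norm_cauchy_term_le assms M)
    also have "\<dots> \<le> (\<Sum>k. M ^ 2 * norm q ^ k)"
      using assms by (intro sum_le_suminf summable_mult) auto
    also have "\<dots> = M ^ 2 * (1 / (1 - norm q))"
      using assms by (simp add: suminf_mult suminf_geometric)
    finally show ?thesis .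
  qed
  then show ?thesis by blast
qed

text \<open>By telescoping, the limit does not depend on \<open>a\<close>; as \<open>a\<close> grows, only the term \<open>k = 0\<close> survives.\<close>

lemma cauchy_sum_tendsto:
  assumes "norm q < 1"
  shows "cauchy_sum q a \<longlonglongrightarrow> 1 / qpoch_inf q q"
proof -
  obtain M where M: "M > 0" "\<And>n. norm (inverse (qpoch q q n)) \<le> M"
    using qpoch_self_inverse_bounded[OF assms] by blast
  define t where "t a k = q ^ (k ^ 2 + a * k) / (qpoch q q k * qpoch q q (k + a))" for a k
  have sM: "summable (\<lambda>k. M ^ 2 * norm q ^ k)"
    using assms by (intro summable_mult) simp
  have bound: "norm (t a k) \<le> M ^ 2 * norm q ^ k" for a k
    unfolding t_def by (intro norm_cauchy_term_le assms M)
  have st: "summable (t a)" for a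
    by (rule summable_comparison_test'[OF sM, of 0]) (rule bound)
  have lim: "cauchy_sum q a \<longlonglongrightarrow> suminf (t a)" for a
    using summable_LIMSEQ[OF st, of a] unfolding cauchy_sum_def t_def .
  have step: "suminf (t (Suc a)) = suminf (t a)" for a
  proof -
    have pw: "(\<lambda>K. q ^ K) \<longlonglongrightarrow> 0"
      using assms by (rule LIMSEQ_power_zero)
    have "(\<lambda>K. t a K * (1 - q ^ K)) \<longlonglongrightarrow> 0 * (1 - 0)"
      by (intro tendsto_mult tendsto_diff tendsto_const pw summable_LIMSEQ_zero st)
    then have "(\<lambda>K. - (t a K * (1 - q ^ K))) \<longlonglongrightarrow> 0"
      using tendsto_minus by fastforce
    then have "(\<lambda>K. cauchy_sum q a K - cauchy_sum q (Suc a) K) \<longlonglongrightarrow> 0"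
      by (simp add: cauchy_sum_telescope[OF assms] t_def)
    moreover have "(\<lambda>K. cauchy_sum q a K - cauchy_sum q (Suc a) K)
        \<longlonglongrightarrow> suminf (t a) - suminf (t (Suc a))"
      by (intro tendsto_diff lim)
    ultimately show ?thesis using LIMSEQ_unique by fastforce
  qed
  then have const: "suminf (t a) = suminf (t 0)" for a
    by (induction a) auto
  define b where "b k = (if k = 0 then 1 / qpoch_inf q q else 0)" for k :: nat
  have shift: "(\<lambda>n. qpoch q q (k + n)) \<longlonglongrightarrow> qpoch_inf q q" for k
    using LIMSEQ_ignore_initial_segment[OF qpoch_tendsto[OF assms, of q], of k]
    by (simp add: add.commute)
  have tb: "(\<lambda>n. t n k) \<longlonglongrightarrow> b k" for k
  proof (cases "k = 0")
    case True
    then show ?thesis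
      using tendsto_inverse[OF shift[of 0]] qpoch_inf_self_nonzero[OF assms]
      by (simp add: t_def b_def divide_inverse)
  next
    case False
    have "norm (q ^ k) < 1" 
      using False assms by (simp add: norm_power power_less_one_iff)
    then have z: "(\<lambda>n. (q ^ k) ^ n) \<longlonglongrightarrow> 0"
      by (rule LIMSEQ_power_zero)
    have "(\<lambda>n. q ^ (k ^ 2) * (q ^ k) ^ n / (qpoch q q k * qpoch q q (k + n)))
       \<longlonglongrightarrow> q ^ (k ^ 2) * 0 / (qpoch q q k * qpoch_inf q q)"
      by (intro tendsto_divide tendsto_mult tendsto_const z shift)
        (use qpoch_inf_self_nonzero[OF assms] qpoch_self_nonzero[OF assms] in auto)
    then show ?thesis
      using False by (simp add: t_def b_def power_add mult.commute flip: power_mult)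
  qed
  have "eventually (\<lambda>(k, n). norm (t n k) \<le> M ^ 2 * norm q ^ k) (at_top \<times>\<^sub>F at_top)"
    by (rule always_eventually) (auto simp: bound)
  from tannerys_theorem[OF tb this sM]
  have "(\<lambda>n. suminf (t n)) \<longlonglongrightarrow> suminf b" by simp
  moreover have "(\<lambda>n. suminf (t n)) = (\<lambda>n. suminf (t 0))" by (rule ext) (rule const)
  ultimately have "(\<lambda>n. suminf (t 0)) \<longlonglongrightarrow> suminf b" by simp
  then have "suminf (t 0) = suminf b" using LIMSEQ_unique tendsto_const by blast
  also have "suminf b = 1 / qpoch_inf q q"
    by (subst suminf_finite[of "{0}"]) (auto simp: b_def)
  finally show ?thesis using lim[of a] const[of a] by simp
qed

lemma sum_lessThan_atMost_swap:
  fixes g :: "nat \<Rightarrow> nat \<Rightarrow> complex"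
  shows "(\<Sum>n<N. \<Sum>s\<le>n. g n s) = (\<Sum>s<N. \<Sum>k<N - s. g (s + k) s)"
proof (induction N)
  case (Suc N)
  have "(\<Sum>s<Suc N. \<Sum>k<Suc N - s. g (s + k) s) = (\<Sum>s<Suc N. (\<Sum>k<N - s. g (s + k) s) + g N s)"
    by (rule sum.cong) (auto simp: Suc_diff_le)
  also have "\<dots> = (\<Sum>s<N. \<Sum>k<N - s. g (s + k) s) + (\<Sum>s\<le>N. g N s)"
    by (simp add: sum.distrib flip: lessThan_Suc_atMost)
  finally show ?case using Suc by simp
qed simp

text \<open>Put \<open>n = s + k\<close>. Then \<open>n^2 = s^2 + (k^2 + 2 s k)\<close> and the
  denominator is \<open>(q;q)_k (q;q)_(k+2s)\<close>, so the inner sum over \<open>k\<close> is a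
  Cauchy sum with parameter \<open>2 * s\<close>, whose limit is the same for every
  \<open>s\<close>.\<close>

lemma bailey_limit:
  fixes a :: "nat \<Rightarrow> complex"
  assumes q: "norm q < 1" and a: "summable (\<lambda>s. norm (a s) * norm q ^ (s ^ 2))"
  shows "(\<lambda>n. q ^ (n ^ 2) * (\<Sum>s\<le>n. a s / (qpoch q q (n - s) * qpoch q q (n + s))))
    sums ((\<Sum>s. a s * q ^ (s ^ 2)) / qpoch_inf q q)"
proof -
  obtain C where C: "norm (cauchy_sum q b K) \<le> C" for b K
    using cauchy_sum_bounded[OF q] by blast
  define f where "f s N = a s * q ^ (s ^ 2) * cauchy_sum q (2 * s) (N - s)" for s N
  have "(\<lambda>N. cauchy_sum q (2 * s) (N - s)) \<longlonglongrightarrow> 1 / qpoch_inf q q" for s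
    by (rule LIMSEQ_offset[of _ s]) (simp add: cauchy_sum_tendsto[OF q])
  then have lim: "(\<lambda>N. f s N) \<longlonglongrightarrow> a s * q ^ (s ^ 2) * (1 / qpoch_inf q q)" for s
    unfolding f_def by (intro tendsto_intros)
  have bound: "norm (f s N) \<le> norm (a s) * norm q ^ (s ^ 2) * C" for s N
    unfolding f_def norm_mult norm_power by (intro mult_left_mono C) auto
  have "(\<lambda>N. \<Sum>s<N. f s N) \<longlonglongrightarrow> (\<Sum>s. a s * q ^ (s ^ 2) * (1 / qpoch_inf q q))"
    by (rule tannery_partial_sums(1)[OF lim bound summable_mult2[OF a]])
  moreover have "(\<Sum>s. a s * q ^ (s ^ 2) * (1 / qpoch_inf q q)) = (\<Sum>s. a s * q ^ (s ^ 2)) / qpoch_inf q q"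
    using suminf_mult2[of "\<lambda>s. a s * q ^ (s ^ 2)" "1 / qpoch_inf q q"] a
    by (simp add: norm_mult norm_power summable_norm_cancel)
  moreover have "(\<Sum>n<N. q ^ (n ^ 2) * (\<Sum>s\<le>n. a s / (qpoch q q (n - s) * qpoch q q (n + s))))
      = (\<Sum>s<N. f s N)" for N
  proof -
    have "(\<Sum>n<N. q ^ (n ^ 2) * (\<Sum>s\<le>n. a s / (qpoch q q (n - s) * qpoch q q (n + s))))
       = (\<Sum>s<N. \<Sum>k<N - s. q ^ ((s + k) ^ 2) * (a s / (qpoch q q (s + k - s) * qpoch q q (s + k + s))))"
      unfolding sum_distrib_left by (rule sum_lessThan_atMost_swap)
    also have "\<dots> = (\<Sum>s<N. f s N)"
      unfolding f_def cauchy_sum_def sum_distrib_left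
      by (intro sum.cong refl)
         (simp add: power2_sum power_add mult_ac add_ac mult_2 mult_2_right)
    finally show ?thesis .
  qed
  ultimately show ?thesis by (simp add: sums_def)
qed

text \<open>The block \<open>m = 0\<close> has only two members; without the conditional, natural
  subtraction (\<open>3 * 0 - 1 = 0\<close>) would count \<open>f 0\<close> twice. The first
  \<open>M\<close> blocks exhaust the indices below \<open>3 * M - 1\<close>.\<close>

lemma sums_group_by_3:
  fixes f :: "nat \<Rightarrow> 'a :: real_normed_vector"
  assumes "f sums L"
  shows "(\<lambda>m. (if m = 0 then 0 else f (3 * m - 1)) + f (3 * m) + f (3 * m + 1)) sums L"
proof -
  have "(\<Sum>m<M. (if m = 0 then 0 else f (3 * m - 1)) + f (3 * m) + f (3 * m + 1)) = (\<Sum>n<3 * M - 1. f n)" for M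
  proof (induction M)
    case (Suc M)
    show ?case
    proof (cases "M = 0")
      case True
      then show ?thesis by (simp add: numeral_2_eq_2)
    next
      case False
      then obtain t where t: "3 * M = Suc t" by (cases "3 * M") auto
      then have eq: "3 * M - 1 = t" "3 * Suc M - 1 = Suc (Suc (Suc t))" by auto
      show ?thesis
        unfolding eq(2) sum.lessThan_Suc Suc.IH unfolding eq(1) using False t by (simp add: add_ac)
    qed
  qed simp
  moreover have "filterlim (\<lambda>M::nat. 3 * M - 1) at_top at_top"
    by (rule filterlim_at_top_mono[OF filterlim_ident]) 
       (auto simp: eventually_sequentially intro!: exI[of _ 1])
  then have "(\<lambda>M. \<Sum>n<3 * M - 1. f n) \<longlonglongrightarrow> L"
    using assms unfolding sums_def by (rule filterlim_compose[rotated])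
  ultimately show ?thesis by (simp add: sums_def)
qed

section \<open>The quintuple product identity\<close>

text \<open>The summand is a q-binomial coefficient times
  \<open>(1 + z q^k) z^k q^(k^2) (z;q)_(n+1) / (z^2 q^k;q)_(n+1)\<close>. The factor
  \<open>(z;q)_(n+1)\<close> is kept inside so that the sum over \<open>k\<close> is 1, the
  normalisation for the Wilf-Zeilberger method.\<close>

definition chen_chu_gu :: "complex \<Rightarrow> complex \<Rightarrow> nat \<Rightarrow> nat \<Rightarrow> complex" where
  "chen_chu_gu q z n k = (1 + z * q ^ k) * qpoch q q n * qpoch z q (Suc n) * z ^ k * q ^ (k ^ 2)
     / (qpoch q q k * qpoch q q (n - k) * qpoch (z ^ 2 * q ^ k) q (Suc n))"

text \<open>The companion in the sense of Wilf and Zeilberger: the forward difference of \<open>chen_chu_gu\<close> in \<open>n\<close>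
  is the backward difference of this function in \<open>k\<close>.\<close>

definition chen_chu_gu_cert :: "complex \<Rightarrow> complex \<Rightarrow> nat \<Rightarrow> nat \<Rightarrow> complex" where
  "chen_chu_gu_cert q z n k = - (q ^ (n - k) * qpoch q q n * qpoch z q (Suc n) * z ^ Suc k * q ^ (Suc k ^ 2)
     / (qpoch q q k * qpoch q q (n - k) * qpoch (z ^ 2 * q ^ Suc k) q (Suc n)))"

text \<open>The base case is the Wilf-Zeilberger relation at \<open>k = 0\<close>, with the
  companion at index -1 read as 0. The bound \<open>K \<le> n\<close> keeps the natural subtractions
  \<open>n - k\<close> exact.\<close>

lemma chen_chu_gu_telescope:
  assumes q: "norm q < 1" and z: "\<And>j. z ^ 2 * q ^ j \<noteq> 1" and "K \<le> n"
  shows "(\<Sum>k\<le>K. chen_chu_gu q z (Suc n) k - chen_chu_gu q z n k) = chen_chu_gu_cert q z n K"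
  using \<open>K \<le> n\<close>
proof (induction K)
  case 0
  define c d A X where "c = qpoch q q n" "d = qpoch (z ^ 2 * q) q n" "A = qpoch z q (Suc n)"
     "X = q ^ n"
  have nz: "c \<noteq> 0" "d \<noteq> 0" "1 - q * X \<noteq> 0" "1 - z ^ 2 \<noteq> 0" "1 - z ^ 2 * q * X \<noteq> 0"
    using qpoch_self_nonzero[OF q, of n] qpoch_nonzero[of "z ^ 2 * q" q n] z[of 0] z[of "Suc n"]
      z[of "Suc _"] power_neq_1[OF q, of "Suc n"]
    by (auto simp: c_d_A_X_def mult.assoc)
  have eqs: "qpoch q q (Suc n) = c * (1 - q * X)" "qpoch z q (Suc (Suc n)) = A * (1 - z * q * X)"
    "qpoch (z ^ 2) q (Suc n) = (1 - z ^ 2) * d"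
    "qpoch (z ^ 2) q (Suc (Suc n)) = (1 - z ^ 2) * d * (1 - z ^ 2 * q * X)"
    "qpoch (z ^ 2 * q) q (Suc n) = d * (1 - z ^ 2 * q * X)"
    unfolding c_d_A_X_def
    by (simp_all add: qpoch_Suc[of "q * z ^ 2"] qpoch_Suc[of q] qpoch_Suc[of z q "Suc n"] mult_ac
          qpoch_Suc_left[of "z ^ 2"])
  show ?case
    using nz by (simp add: chen_chu_gu_def chen_chu_gu_cert_def eqs flip: c_d_A_X_def)
      (simp add: divide_simps, simp add: algebra_simps power2_eq_square)
next
  case (Suc K)
  \<comment> \<open>With \<open>n = K + 1 + p\<close>, the powers of \<open>q\<close> with linear
    exponents become monomials in \<open>q\<close>, \<open>Y = q^K\<close> and
    \<open>W = q^p\<close>; the quadratic exponent survives only in the common factor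
    \<open>e\<close>.\<close>
  then obtain p where n: "n = Suc (K + p)" 
    by (metis Suc_le_D add_Suc le_iff_add)
  define a b A d Y W where "a = qpoch q q K" "b = qpoch q q p" "A = qpoch z q (Suc n)"
    "d = qpoch (z ^ 2 * q ^ Suc (Suc K)) q n" "Y = q ^ K" "W = q ^ p"
  define c where "c = qpoch q q n"
  have zq: "1 - z ^ 2 * q * Y \<noteq> 0" "1 - z ^ 2 * q ^ 3 * Y ^ 2 * W \<noteq> 0"
    using z[of "Suc K"] z[of "Suc K + Suc n"]
    by (auto simp: n a_b_A_d_Y_W_def power_add power2_eq_square mult_ac eval_nat_numeral)
  have nz: "a \<noteq> 0" "b \<noteq> 0" "d \<noteq> 0" "1 - q * Y \<noteq> 0" "1 - q * W \<noteq> 0" "1 - q ^ 2 * W \<noteq> 0"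
    using qpoch_self_nonzero[OF q] power_neq_1[OF q, of "Suc _"] power_neq_1[OF q, of "Suc (Suc p)"] 
      qpoch_nonzero[of "z ^ 2 * q ^ Suc (Suc K)" q n] z
    by (auto simp: a_b_A_d_Y_W_def mult.assoc power2_eq_square simp flip: power_Suc power_add)
  have eqs: "qpoch q q (Suc n) = c * (1 - q ^ 2 * Y * W)" 
    "qpoch z q (Suc (Suc n)) = A * (1 - z * q ^ 2 * Y * W)"
    "qpoch q q (Suc K) = a * (1 - q * Y)"
    "qpoch q q (n - K) = b * (1 - q * W)"
    "qpoch q q (n - Suc K) = b"
    "qpoch q q (Suc n - Suc K) = b * (1 - q * W)"
    "q ^ Suc K = q * Y" "q ^ (n - Suc K) = W" "q ^ (n - K) = q * W"
    unfolding a_b_A_d_Y_W_def c_def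
    by (simp_all add: n qpoch_Suc[of q] qpoch_Suc[of z q "Suc _"] power_add power2_eq_square power3_eq_cube mult_ac)
  have wq: "z ^ 2 * q ^ Suc K * q = z ^ 2 * q ^ Suc (Suc K)" "z ^ 2 * q ^ Suc K = z ^ 2 * q * Y"
    "z ^ 2 * q ^ Suc (Suc K) * q ^ n = z ^ 2 * q ^ 3 * Y ^ 2 * W"
    by (simp_all add: n a_b_A_d_Y_W_def(5,6) power_add power2_eq_square power3_eq_cube mult_ac)
  have eqs_d: "qpoch (z ^ 2 * q ^ Suc K) q (Suc n) = (1 - z ^ 2 * q * Y) * d"
    "qpoch (z ^ 2 * q ^ Suc K) q (Suc (Suc n)) = (1 - z ^ 2 * q * Y) * d * (1 - z ^ 2 * q ^ 3 * Y ^ 2 * W)"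
    "qpoch (z ^ 2 * q ^ Suc (Suc K)) q (Suc n) = d * (1 - z ^ 2 * q ^ 3 * Y ^ 2 * W)"
    using qpoch_Suc_left[of "z ^ 2 * q ^ Suc K" q n] qpoch_Suc_left[of "z ^ 2 * q ^ Suc K" q "Suc n"]
      qpoch_Suc[of "z ^ 2 * q ^ Suc (Suc K)" q n]
    unfolding wq(1) wq(3) a_b_A_d_Y_W_def(4)[symmetric]
    by (simp_all only: wq(2) mult.assoc)
  have E: "q ^ (Suc (Suc K) ^ 2) = q ^ (Suc K ^ 2) * q ^ 3 * Y ^ 2"
  proof -
    have "Suc (Suc K) ^ 2 = Suc K ^ 2 + 3 + K * 2" by (simp add: power2_eq_square)
    then show ?thesis unfolding a_b_A_d_Y_W_def(5) by (simp only: power_add power_mult)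
  qed
  define e where "e = q ^ (Suc K ^ 2)"
  define Z where "Z = z ^ Suc K"
  \<comment> \<open>Removing the factor common to all three terms leaves a rational identity in
    \<open>a\<close>, \<open>b\<close>, \<open>d\<close>, \<open>q\<close>, \<open>z\<close>,
    \<open>Y\<close> and \<open>W\<close> that is settled by clearing denominators.\<close>
  have factor: "- (w * c * A * Z * e / D1) + (u * (c * x) * (A * y) * Z * e / D2 - u * c * A * Z * e / D3)
     = A * c * Z * e * (- (w / D1) + u * x * y / D2 - u / D3)" for w u x y D1 D2 D3
    by (simp add: algebra_simps)
  have "(\<Sum>k\<le>Suc K. chen_chu_gu q z (Suc n) k - chen_chu_gu q z n k)
     = chen_chu_gu_cert q z n K + (chen_chu_gu q z (Suc n) (Suc K) - chen_chu_gu q z n (Suc K))"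
    using Suc by simp
  also have "\<dots> = A * c * Z * e * (- (q * W / (a * (b * (1 - q * W)) * ((1 - z ^ 2 * q * Y) * d)))
     + (1 + z * (q * Y)) * (1 - q ^ 2 * Y * W) * (1 - z * q ^ 2 * Y * W)
       / (a * (1 - q * Y) * (b * (1 - q * W)) * ((1 - z ^ 2 * q * Y) * d * (1 - z ^ 2 * q ^ 3 * Y ^ 2 * W)))
     - (1 + z * (q * Y)) / (a * (1 - q * Y) * b * ((1 - z ^ 2 * q * Y) * d)))"
    unfolding chen_chu_gu_def chen_chu_gu_cert_def eqs_d
    unfolding eqs c_def[symmetric] e_def[symmetric] a_b_A_d_Y_W_def(1-3)[symmetric] Z_def[symmetric]
    by (rule factor)
  also have "\<dots> = A * c * Z * e * - (W * z * q ^ 3 * Y ^ 2 / (a * (1 - q * Y) * b * (d * (1 - z ^ 2 * q ^ 3 * Y ^ 2 * W))))"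
    apply (rule arg_cong[of _ _ "\<lambda>x. A * c * Z * e * x"])
    using nz zq by (simp add: divide_simps) (simp add: algebra_simps power2_eq_square power3_eq_cube)
  also have "\<dots> = chen_chu_gu_cert q z n (Suc K)"
    unfolding chen_chu_gu_cert_def eqs_d
    unfolding eqs E c_def[symmetric] e_def[symmetric] a_b_A_d_Y_W_def(1-3)[symmetric] Z_def[symmetric] power_Suc[of z "Suc K"]
    by (simp add: algebra_simps)
  finally show ?case .
qed

text \<open>Passing from \<open>n\<close> to \<open>n + 1\<close> changes the terms with
  \<open>k \<le> n\<close> by \<open>chen_chu_gu_cert q z n n\<close> in total, and the new term
  \<open>k = n + 1\<close> is exactly its negative, because \<open>1 - z^2 q^(2n+2)\<close> splits
  into two linear factors in \<open>z\<close>.\<close>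

lemma chen_chu_gu_sum:
  assumes q: "norm q < 1" and z: "\<And>j. z ^ 2 * q ^ j \<noteq> 1"
  shows "(\<Sum>k\<le>n. chen_chu_gu q z n k) = 1"
proof (induction n)
  case 0
  have "1 - z ^ 2 = (1 + z) * (1 - z)" by (simp add: algebra_simps power2_eq_square)
  moreover have "1 - z ^ 2 \<noteq> 0" using z[of 0] by simp
  ultimately show ?case by (simp add: chen_chu_gu_def qpoch_Suc)
next
  case (Suc n)
  let ?w = "z ^ 2 * q ^ Suc n"
  have nz: "qpoch q q n \<noteq> 0" "qpoch q q (Suc n) \<noteq> 0" "qpoch ?w q (Suc n) \<noteq> 0" 
    "1 - ?w * q ^ Suc n \<noteq> 0"
    using qpoch_self_nonzero[OF q] qpoch_nonzero[of ?w q "Suc n"] z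
    by (auto simp: mult.assoc simp del: power_Suc simp flip: power_add)
  have "1 - ?w * q ^ Suc n = (1 + z * q ^ Suc n) * (1 - z * q ^ Suc n)"
    by (simp add: algebra_simps power2_eq_square)
  then have "chen_chu_gu q z (Suc n) (Suc n) = - chen_chu_gu_cert q z n n"
    using nz unfolding chen_chu_gu_def chen_chu_gu_cert_def qpoch_Suc[of z q "Suc n"] qpoch_Suc[of ?w q "Suc n"]
    by (simp add: divide_simps del: power_Suc)
  then have "(\<Sum>k\<le>Suc n. chen_chu_gu q z (Suc n) k) = (\<Sum>k\<le>n. chen_chu_gu q z (Suc n) k) - chen_chu_gu_cert q z n n"
    by simp
  also have "\<dots> = (\<Sum>k\<le>n. chen_chu_gu q z n k)"
    using chen_chu_gu_telescope[OF q z order_refl, of n] by (simp add: sum_subtractf algebra_simps)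
  finally show ?case using Suc by simp
qed

section \<open>The finite identity recentred at its middle term\<close>

text \<open>Each factor \<open>1 - w / q^i\<close> equals \<open>- (w / q^i) (1 - q^i / w)\<close>;
  the exponents \<open>i = 1, ..., n\<close> add up to \<open>triangle n\<close>.\<close>

lemma qpoch_reflect:
  assumes "q \<noteq> 0" "w \<noteq> 0"
  shows "qpoch (w / q ^ n) q n = (- w) ^ n * qpoch (q / w) q n / q ^ triangle n"
proof (induction n)
  case 0
  show ?case by simp
next
  case (Suc n)
  have "qpoch (w / q ^ Suc n) q (Suc n) = (1 - w / q ^ Suc n) * qpoch (w / q ^ n) q n"
    using assms by (simp add: qpoch_Suc_left)
  also have "1 - w / q ^ Suc n = - w * (1 - q / w * q ^ n) / q ^ Suc n"
    using assms by (simp add: field_simps)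
  finally show ?case
    unfolding Suc by (simp add: qpoch_Suc power_add mult_ac)
qed

lemma triangle_add: "triangle (m + n) = triangle m + triangle n + m * n"
  by (induction n) auto

lemma triangle_double: "triangle n + triangle n = n + n * n"
  by (induction n) auto

text \<open>
  Substituting \<open>n = 2N\<close> and \<open>z / q\<^sup>N\<close> for \<open>z\<close> makes the finite sum symmetric around \<open>k = N\<close>; its
  terms at \<open>N + r\<close> and \<open>N - r\<close> tend to multiples of \<open>quint_pos\<close> and \<open>quint_neg\<close>, the terms at
  \<open>r\<close> and \<open>-r\<close> of the bilateral series of \<open>(-1)\<^sup>r (1 + z q\<^sup>r) z\<^bsup>3r\<^esup> q\<^bsup>r(3r-1)/2\<^esup>\<close>.
  The exponent \<open>r(3r-1)/2\<close> is written \<open>r\<^sup>2 + triangle r - r\<close>.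
\<close>

definition quint_weight :: "complex \<Rightarrow> complex \<Rightarrow> nat \<Rightarrow> nat \<Rightarrow> complex" where
  "quint_weight q z k p =
     1 / (qpoch q q k * qpoch q q p * qpoch (q / z ^ 2) q p * qpoch (z ^ 2) q (Suc k))"

definition quint_prefactor :: "complex \<Rightarrow> complex \<Rightarrow> nat \<Rightarrow> complex" where
  "quint_prefactor q z N = qpoch q q (2 * N) * qpoch (q / z) q N * qpoch z q (Suc N)"

definition quint_pos :: "complex \<Rightarrow> complex \<Rightarrow> nat \<Rightarrow> complex" where
  "quint_pos q z r = (- 1) ^ r * (1 + z * q ^ r) * z ^ (3 * r) * q ^ (r ^ 2 + triangle r) / q ^ r"

definition quint_neg :: "complex \<Rightarrow> complex \<Rightarrow> nat \<Rightarrow> complex" where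
  "quint_neg q z r = (- 1) ^ r * (1 + z / q ^ r) * q ^ (r ^ 2 + triangle r) / z ^ (3 * r)"

text \<open>The symbols with negative powers of \<open>q\<close> are cut where these end:
  \<open>(z / q^N;q)_(2N+1)\<close> after \<open>N\<close> factors and, as
  \<open>(z / q^N)^2 q^k = z^2 / q^p\<close>, the denominator after \<open>p\<close> factors.
  Reflection turns the first pieces into convergent symbols times monomials.
  \<open>quint_prefactor\<close> collects the symbols independent of \<open>k\<close>, the last
  factor all monomials.\<close>

lemma chen_chu_gu_shift:
  assumes "q \<noteq> 0" "z \<noteq> 0" "k + p = 2 * N"
  shows "chen_chu_gu q (z / q ^ N) (2 * N) k = quint_prefactor q z N * quint_weight q z k p *
    ((1 + z * q ^ k / q ^ N) * (- z) ^ N * z ^ k * q ^ (k ^ 2 + triangle p)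
      / (q ^ (triangle N + N * k) * (- (z ^ 2)) ^ p))"
proof -
  have p: "2 * N - k = p" using assms(3) by simp
  have "q ^ k * q ^ p = q ^ N * q ^ N"
    using assms(3) by (simp flip: power_add add: mult_2)
  then have w: "(z / q ^ N) ^ 2 * q ^ k = z ^ 2 / q ^ p"
    using assms by (simp add: power_divide field_simps power2_eq_square)
  have "qpoch (z / q ^ N) q (Suc (2 * N)) = qpoch (z / q ^ N) q N * qpoch z q (Suc N)"
    using qpoch_add[of "z / q ^ N" q N "Suc N"] assms by (simp add: mult_2)
  then have 1: "qpoch (z / q ^ N) q (Suc (2 * N))
      = (- z) ^ N * qpoch (q / z) q N / q ^ triangle N * qpoch z q (Suc N)"
    using assms by (simp add: qpoch_reflect)
  have "Suc (2 * N) = p + Suc k" using assms(3) by simp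
  then have "qpoch (z ^ 2 / q ^ p) q (Suc (2 * N)) = qpoch (z ^ 2 / q ^ p) q p * qpoch (z ^ 2) q (Suc k)"
    unfolding \<open>Suc (2 * N) = p + Suc k\<close> using qpoch_add[of "z ^ 2 / q ^ p" q p "Suc k"] assms(1,2) by (simp del: add_Suc_right)
  then have 2: "qpoch (z ^ 2 / q ^ p) q (Suc (2 * N))
      = (- (z ^ 2)) ^ p * qpoch (q / z ^ 2) q p / q ^ triangle p * qpoch (z ^ 2) q (Suc k)"
    using assms by (simp add: qpoch_reflect)
  show ?thesis
    unfolding chen_chu_gu_def p w 1 2 quint_prefactor_def quint_weight_def
    using assms(1,2) by (simp add: power_divide power_add mult_ac flip: power_mult)
qed

lemma chen_chu_gu_shift_pos:
  assumes "q \<noteq> 0" "z \<noteq> 0" "r \<le> N"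
  shows "chen_chu_gu q (z / q ^ N) (2 * N) (N + r)
    = quint_prefactor q z N * (quint_pos q z r * quint_weight q z (N + r) (N - r))"
proof -
  obtain p where N: "N = p + r" using assms(3) by (metis le_add_diff_inverse2)
  \<comment> \<open>The exponents are compared without subtraction: the summand \<open>r\<close> on
    the left stands for the division by \<open>q ^ r\<close> in \<open>quint_pos\<close>.\<close>
  have "(N + r) ^ 2 + triangle p + r = triangle N + N * (N + r) + (r ^ 2 + triangle r)"
    using triangle_double[of r] by (simp add: N triangle_add power2_eq_square algebra_simps)
  then have "q ^ ((N + r) ^ 2 + triangle p) * q ^ r = q ^ (triangle N + N * (N + r)) * q ^ (r ^ 2 + triangle r)"
    by (simp only: flip: power_add)
  then have e: "q ^ ((N + r) ^ 2 + triangle p) = q ^ (triangle N + N * (N + r)) * q ^ (r ^ 2 + triangle r) / q ^ r"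
    using assms by (simp add: field_simps)
  have "(- z) ^ N * z ^ (N + r) = ((- 1) ^ r * z ^ (3 * r)) * (- (z ^ 2)) ^ p"
    unfolding N power_minus[of z] power_minus[of "z ^ 2"]
    by (simp add: power_add mult_ac power2_eq_square power3_eq_cube power_mult power_mult_distrib)
  then have s: "(- z) ^ N * z ^ (N + r) / (- (z ^ 2)) ^ p = (- 1) ^ r * z ^ (3 * r)"
    using assms by (simp add: field_simps)
  have "(1 + z * q ^ (N + r) / q ^ N) * (- z) ^ N * z ^ (N + r) * q ^ ((N + r) ^ 2 + triangle p)
      / (q ^ (triangle N + N * (N + r)) * (- (z ^ 2)) ^ p)
    = (1 + z * q ^ r) * ((- z) ^ N * z ^ (N + r) / (- (z ^ 2)) ^ p) * (q ^ (r ^ 2 + triangle r) / q ^ r)"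
    unfolding e using assms by (simp add: power_add mult_ac)
  also have "\<dots> = quint_pos q z r"
    unfolding s quint_pos_def by (simp add: mult_ac)
  finally show ?thesis
    using chen_chu_gu_shift[OF assms(1,2), of "N + r" p N] by (simp add: N mult_ac)
qed

lemma chen_chu_gu_shift_neg:
  assumes "q \<noteq> 0" "z \<noteq> 0" "r \<le> N"
  shows "chen_chu_gu q (z / q ^ N) (2 * N) (N - r)
    = quint_prefactor q z N * (quint_neg q z r * quint_weight q z (N - r) (N + r))"
proof -
  obtain k where N: "N = k + r" using assms(3) by (metis le_add_diff_inverse2)
  have "k ^ 2 + triangle (N + r) = triangle N + N * k + (r ^ 2 + triangle r)"
    using triangle_double[of r] by (simp add: N triangle_add power2_eq_square algebra_simps)
  then have e: "q ^ (k ^ 2 + triangle (N + r)) = q ^ (triangle N + N * k) * q ^ (r ^ 2 + triangle r)"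
    by (simp only: flip: power_add)
  have "(- z) ^ N * z ^ k * z ^ (3 * r) = (- 1) ^ r * (- (z ^ 2)) ^ (N + r)"
    unfolding N power_minus[of z] power_minus[of "z ^ 2"]
    by (simp add: power_add mult_ac power2_eq_square power3_eq_cube power_mult power_mult_distrib)
  then have s: "(- z) ^ N * z ^ k / (- (z ^ 2)) ^ (N + r) = (- 1) ^ r / z ^ (3 * r)"
    using assms by (simp add: field_simps)
  have "(1 + z * q ^ k / q ^ N) * (- z) ^ N * z ^ k * q ^ (k ^ 2 + triangle (N + r))
      / (q ^ (triangle N + N * k) * (- (z ^ 2)) ^ (N + r))
    = (1 + z / q ^ r) * ((- z) ^ N * z ^ k / (- (z ^ 2)) ^ (N + r)) * q ^ (r ^ 2 + triangle r)"
    unfolding e using assms by (simp add: N power_add mult_ac)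
  also have "\<dots> = quint_neg q z r"
    unfolding s quint_neg_def by (simp add: mult_ac)
  finally show ?thesis
    using chen_chu_gu_shift[OF assms(1,2), of k "N + r" N] by (simp add: N mult_ac)
qed

section \<open>The limit of the recentred identity\<close>

lemma sum_atMost_add:
  fixes f :: "nat \<Rightarrow> 'a :: comm_monoid_add"
  shows "(\<Sum>k\<le>N + M. f k) = (\<Sum>k\<le>N. f k) + (\<Sum>r<M. f (N + Suc r))"
  by (induction M) (simp_all add: add.assoc)

lemma sum_around_middle:
  fixes f :: "nat \<Rightarrow> 'a :: comm_monoid_add"
  shows "(\<Sum>k\<le>2 * N. f k) = f N + (\<Sum>r<N. f (N + Suc r) + f (N - Suc r))"
proof -
  have "(\<Sum>k\<le>2 * N. f k) = (\<Sum>k\<le>N. f k) + (\<Sum>r<N. f (N + Suc r))"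
    unfolding mult_2 by (rule sum_atMost_add)
  also have "(\<Sum>k\<le>N. f k) = f N + (\<Sum>k<N. f k)"
    by (simp add: add.commute flip: lessThan_Suc_atMost)
  also have "(\<Sum>k<N. f k) = (\<Sum>r<N. f (N - Suc r))"
    by (rule sum.nat_diff_reindex[symmetric])
  finally show ?thesis by (simp add: sum.distrib add_ac)
qed

text \<open>The ratio of consecutive terms is \<open>x * c^(2n+1)\<close>, which tends to 0 however
  large \<open>x\<close> is. This matters because the majorant below involves both
  \<open>norm z ^ 3\<close> and its reciprocal.\<close>

lemma summable_power_times_square_power:
  fixes x c :: real
  assumes "0 \<le> x" "0 \<le> c" "c < 1"
  shows "summable (\<lambda>r. x ^ r * c ^ (r ^ 2))"
proof -
  have "(\<lambda>n. c ^ n) \<longlonglongrightarrow> 0" using assms by (simp add: LIMSEQ_power_zero)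
  then have "(\<lambda>n. x * c ^ n) \<longlonglongrightarrow> 0" using tendsto_mult_right_zero by blast
  then have "eventually (\<lambda>n. x * c ^ n < 1 / 2) sequentially"
    by (rule order_tendstoD) simp
  then obtain N where N: "x * c ^ n < 1 / 2" if "n \<ge> N" for n
    by (auto simp: eventually_sequentially)
  show ?thesis
  proof (rule summable_ratio_test[where c = "1 / 2" and N = N])
    fix n assume "N \<le> n"
    have "x ^ Suc n * c ^ (Suc n ^ 2) = (x * c ^ (2 * n + 1)) * (x ^ n * c ^ (n ^ 2))"
      by (simp add: power2_eq_square power_add mult_2 mult_2_right algebra_simps)
    also have "\<dots> \<le> 1 / 2 * (x ^ n * c ^ (n ^ 2))"
      using N[of "2 * n + 1"] \<open>N \<le> n\<close> assms by (intro mult_right_mono) auto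
    finally show "norm (x ^ Suc n * c ^ (Suc n ^ 2)) \<le> 1 / 2 * norm (x ^ n * c ^ (n ^ 2))"
      using assms by (simp del: power_Suc)
  qed simp
qed

text \<open>\<open>R\<close> and \<open>1 / D\<close> are the limits of
  \<open>quint_prefactor\<close> and \<open>quint_weight\<close>. The condition on \<open>z\<close>
  says that \<open>z^2\<close> is no integer power of \<open>q\<close> of either sign, so neither
  \<open>(z^2;q)_inf\<close> nor \<open>(q/z^2;q)_inf\<close> vanishes. The central term
  \<open>1 + z\<close> of the bilateral series is moved to the right.\<close>

lemma quintuple_product:
  fixes q z :: complex
  assumes q: "q \<noteq> 0" "norm q < 1" and z: "z \<noteq> 0" "\<And>i j. z ^ 2 * q ^ i \<noteq> q ^ j"
  shows "(\<lambda>r. quint_pos q z (Suc r) + quint_neg q z (Suc r)) sums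
    (qpoch_inf q q * qpoch_inf (- z) q * qpoch_inf (- q / z) q
      * qpoch_inf (z ^ 2 * q) (q ^ 2) * qpoch_inf (q / z ^ 2) (q ^ 2) - (1 + z))"
proof -
  define R where "R = qpoch_inf q q * qpoch_inf (q / z) q * qpoch_inf z q"
  define D where "D = qpoch_inf q q * qpoch_inf q q * qpoch_inf (q / z ^ 2) q * qpoch_inf (z ^ 2) q"
  have nz2: "z ^ 2 * q ^ j \<noteq> 1" for j using z(2)[of j 0] by simp
  have nz2': "q / z ^ 2 * q ^ j \<noteq> 1" for j using z(2)[of 0 "Suc j"] z(1) by (simp add: field_simps)
  have D0: "D \<noteq> 0"
    using qpoch_inf_nonzero[OF q(2), of "z ^ 2"] qpoch_inf_nonzero[OF q(2), of "q / z ^ 2"] nz2 nz2'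
      qpoch_inf_self_nonzero[OF q(2)] unfolding D_def by (simp only: mult_eq_0_iff simp_thms)
  have shift: "(\<lambda>N. qpoch a q (N + r)) \<longlonglongrightarrow> qpoch_inf a q" for a r
    by (rule LIMSEQ_ignore_initial_segment[OF qpoch_tendsto[OF q(2)]])
  have shift': "(\<lambda>N. qpoch a q (N - r)) \<longlonglongrightarrow> qpoch_inf a q" for a r
    by (rule LIMSEQ_offset[of _ r]) (simp add: qpoch_tendsto[OF q(2)])
  have "(\<lambda>N. qpoch q q (2 * N)) \<longlonglongrightarrow> qpoch_inf q q"
    using LIMSEQ_subseq_LIMSEQ[OF qpoch_tendsto[OF q(2)], of "\<lambda>n. 2 * n"]
    by (simp add: strict_mono_def comp_def)
  then have Rlim: "quint_prefactor q z \<longlonglongrightarrow> R"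
    unfolding quint_prefactor_def[abs_def] R_def using shift[of z 1]
    by (intro tendsto_mult qpoch_tendsto q) simp_all
  have Wpos: "(\<lambda>N. quint_weight q z (N + r) (N - r)) \<longlonglongrightarrow> 1 / D" for r
    unfolding quint_weight_def D_def using shift[of "z ^ 2" "Suc r"] D0
    by (intro tendsto_divide tendsto_mult tendsto_const shift shift') (simp_all add: D_def)
  have Wneg: "(\<lambda>N. quint_weight q z (N - r) (N + r)) \<longlonglongrightarrow> 1 / D" for r
  proof -
    have "(\<lambda>N. qpoch (z ^ 2) q (Suc (N - r))) \<longlonglongrightarrow> qpoch_inf (z ^ 2) q"
      by (rule LIMSEQ_offset[of _ r]) (use shift[of "z ^ 2" 1] in simp)
    then show ?thesis
      unfolding quint_weight_def D_def using D0
      by (intro tendsto_divide tendsto_mult tendsto_const shift shift') (simp_all add: D_def)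
  qed
  obtain M where M: "M > 0" "\<And>n. norm (inverse (qpoch q q n)) \<le> M"
    using qpoch_self_inverse_bounded[OF q(2)] by blast
  obtain M1 where M1: "M1 > 0" "\<And>n. norm (inverse (qpoch (z ^ 2) q n)) \<le> M1"
    using qpoch_inverse_bounded[OF q(2) nz2] by blast
  obtain M2 where M2: "M2 > 0" "\<And>n. norm (inverse (qpoch (q / z ^ 2) q n)) \<le> M2"
    using qpoch_inverse_bounded[OF q(2) nz2'] by blast
  define C where "C = M * M * M2 * M1"
  have Wbound: "norm (quint_weight q z k p) \<le> C" for k p
  proof -
    have "norm (quint_weight q z k p) = norm (inverse (qpoch q q k)) * norm (inverse (qpoch q q p))
       * norm (inverse (qpoch (q / z ^ 2) q p)) * norm (inverse (qpoch (z ^ 2) q (Suc k)))"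
      unfolding quint_weight_def by (simp add: norm_mult norm_inverse norm_divide divide_inverse)
    also have "\<dots> \<le> C"
      unfolding C_def using M M1 M2 by (intro mult_mono mult_nonneg_nonneg) (auto intro: less_imp_le)
    finally show ?thesis .
  qed
  define B where "B r = (1 + norm z) * ((norm z ^ 3) ^ r * norm q ^ (r ^ 2))
      + (1 + norm z) * ((1 / norm z ^ 3) ^ r * norm q ^ (r ^ 2))" for r
  have sB: "summable B"
    unfolding B_def by (intro summable_add summable_mult summable_power_times_square_power) (use q in auto)
  have qr: "norm q ^ r \<le> 1" for r using q by (simp add: power_le_one)
  \<comment> \<open>The surplus \<open>triangle r - r\<close> is nonnegative, so
    \<open>q^(triangle r)\<close> absorbs the division by \<open>q ^ r\<close> in
    \<open>quint_pos\<close> and in the factor \<open>1 + z / q ^ r\<close> of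
    \<open>quint_neg\<close>.\<close>
  have tri: "r \<le> triangle r" for r by (induction r) auto
  have pos_bound: "norm (quint_pos q z r) \<le> (1 + norm z) * ((norm z ^ 3) ^ r * norm q ^ (r ^ 2))" for r
  proof -
    obtain t where t: "triangle r = r + t" using tri[of r] le_Suc_ex by blast
    have "norm (quint_pos q z r) = norm (1 + z * q ^ r) * ((norm z ^ 3) ^ r * norm q ^ (r ^ 2 + t))"
      using q by (simp add: quint_pos_def t norm_mult norm_divide norm_power power_add power_mult)
    also have "\<dots> \<le> (1 + norm z) * ((norm z ^ 3) ^ r * norm q ^ (r ^ 2))"
    proof (intro mult_mono)
      have "norm (1 + z * q ^ r) \<le> 1 + norm z * norm q ^ r"
        by (rule order_trans[OF norm_triangle_ineq]) (simp add: norm_mult norm_power)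
      also have "\<dots> \<le> 1 + norm z" using qr[of r] by (simp add: mult_left_le)
      finally show "norm (1 + z * q ^ r) \<le> 1 + norm z" .
      show "norm q ^ (r ^ 2 + t) \<le> norm q ^ (r ^ 2)" 
        using q by (intro power_decreasing) auto
    qed auto
    finally show ?thesis .
  qed
  have neg_bound: "norm (quint_neg q z r) \<le> (1 + norm z) * ((1 / norm z ^ 3) ^ r * norm q ^ (r ^ 2))" for r
  proof -
    obtain t where t: "triangle r = r + t" using tri[of r] le_Suc_ex by blast
    have "1 + z / q ^ r = (q ^ r + z) / q ^ r" using q by (simp add: field_simps)
    then have "norm (quint_neg q z r) = norm (q ^ r + z) * ((1 / norm z ^ 3) ^ r * norm q ^ (r ^ 2 + t))"
      using q by (simp add: quint_neg_def t norm_mult norm_divide norm_power power_add power_mult power_divide)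
    also have "\<dots> \<le> (1 + norm z) * ((1 / norm z ^ 3) ^ r * norm q ^ (r ^ 2))"
    proof (intro mult_mono)
      have "norm (q ^ r + z) \<le> norm q ^ r + norm z"
        by (rule order_trans[OF norm_triangle_ineq]) (simp add: norm_power)
      then show "norm (q ^ r + z) \<le> 1 + norm z" using qr[of r] by simp
      show "norm q ^ (r ^ 2 + t) \<le> norm q ^ (r ^ 2)" 
        using q by (intro power_decreasing) auto
    qed auto
    finally show ?thesis .
  qed
  define f where "f r N = quint_pos q z (Suc r) * quint_weight q z (N + Suc r) (N - Suc r)
     + quint_neg q z (Suc r) * quint_weight q z (N - Suc r) (N + Suc r)" for r N
  define b where "b r = (quint_pos q z (Suc r) + quint_neg q z (Suc r)) * (1 / D)" for r
  have flim: "(\<lambda>N. f r N) \<longlonglongrightarrow> b r" for r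
    unfolding f_def b_def distrib_right by (intro tendsto_intros Wpos Wneg)
  have fbound: "norm (f r N) \<le> B (Suc r) * C" for r N
  proof -
    have "0 < C" using M M1 M2 by (simp add: C_def)
    then have "norm (f r N) \<le> (1 + norm z) * ((norm z ^ 3) ^ Suc r * norm q ^ (Suc r ^ 2)) * C
        + (1 + norm z) * ((1 / norm z ^ 3) ^ Suc r * norm q ^ (Suc r ^ 2)) * C"
      unfolding f_def
      by (intro norm_triangle_mono; unfold norm_mult; intro mult_mono pos_bound neg_bound Wbound) auto
    then show ?thesis by (simp only: B_def distrib_right)
  qed
  have sBC: "summable (\<lambda>r. B (Suc r) * C)"
    using sB by (intro summable_mult2) (simp add: summable_Suc_iff)
  have flimit: "(\<lambda>N. \<Sum>r<N. f r N) \<longlonglongrightarrow> suminf b" and sb: "summable b"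
    using tannery_partial_sums[of f b "\<lambda>r. B (Suc r) * C"] flim fbound sBC by auto
  have finite: "quint_prefactor q z N * ((1 + z) * quint_weight q z N N + (\<Sum>r<N. f r N)) = 1" for N
  proof -
    \<comment> \<open>The shifted argument is admissible for every \<open>N\<close>: equality would
      mean \<open>z^2 q^j = q^(2N)\<close>.\<close>
    have "(z / q ^ N) ^ 2 * q ^ j \<noteq> 1" for j
      using z(2)[of j "N * 2"] q by (simp add: power_divide field_simps flip: power_mult)
    then have "1 = (\<Sum>k\<le>2 * N. chen_chu_gu q (z / q ^ N) (2 * N) k)"
      by (intro chen_chu_gu_sum[symmetric] q)
    also have "\<dots> = chen_chu_gu q (z / q ^ N) (2 * N) (N + 0)
       + (\<Sum>r<N. chen_chu_gu q (z / q ^ N) (2 * N) (N + Suc r) + chen_chu_gu q (z / q ^ N) (2 * N) (N - Suc r))"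
      by (simp only: sum_around_middle add_0_right)
    also have "chen_chu_gu q (z / q ^ N) (2 * N) (N + 0) = quint_prefactor q z N * ((1 + z) * quint_weight q z N N)"
      by (subst chen_chu_gu_shift_pos) (use q z in \<open>auto simp: quint_pos_def\<close>)
    also have "(\<Sum>r<N. chen_chu_gu q (z / q ^ N) (2 * N) (N + Suc r) + chen_chu_gu q (z / q ^ N) (2 * N) (N - Suc r))
       = (\<Sum>r<N. quint_prefactor q z N * f r N)"
      by (intro sum.cong refl) (simp only: lessThan_iff Suc_le_eq f_def
           chen_chu_gu_shift_pos[OF q(1) z(1)] chen_chu_gu_shift_neg[OF q(1) z(1)] distrib_left)
    finally show ?thesis by (simp add: sum_distrib_left distrib_left)
  qed
  have "(\<lambda>N. quint_prefactor q z N * ((1 + z) * quint_weight q z N N + (\<Sum>r<N. f r N)))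
      \<longlonglongrightarrow> R * ((1 + z) * (1 / D) + suminf b)"
    using Wpos[of 0] by (intro tendsto_intros Rlim flimit) simp
  then have "(\<lambda>N. 1) \<longlonglongrightarrow> R * ((1 + z) * (1 / D) + suminf b)"
    by (simp only: finite)
  then have one: "R * ((1 + z) * (1 / D) + suminf b) = 1"
    using LIMSEQ_unique tendsto_const by blast
  \<comment> \<open>That \<open>R\<close> is nonzero is read off from the limit identity itself,
    since a product with factor \<open>R\<close> equals 1.\<close>
  then have R0: "R \<noteq> 0" by auto
  have "suminf b * D = D / R - (1 + z)"
    using one R0 D0 by (simp add: field_simps)
  moreover have "(\<lambda>r. b r * D) sums (suminf b * D)"
    using sb by (intro sums_mult2) (rule summable_sums)
  ultimately have "(\<lambda>r. quint_pos q z (Suc r) + quint_neg q z (Suc r)) sums (D / R - (1 + z))"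
    using D0 by (simp add: b_def)
  \<comment> \<open>Splitting \<open>(z^2;q)_inf\<close> and \<open>(q/z^2;q)_inf\<close> by the
    parity of the index produces \<open>(z^2;q^2)_inf\<close> and \<open>((q/z)^2;q^2)_inf\<close>.
    Their arguments are squares, so they split once more, and \<open>R\<close> cancels.\<close>
  moreover have "D = qpoch_inf q q * qpoch_inf q q 
      * (qpoch_inf (q / z ^ 2) (q ^ 2) * (qpoch_inf (q / z) q * qpoch_inf (- q / z) q))
      * (qpoch_inf z q * qpoch_inf (- z) q * qpoch_inf (z ^ 2 * q) (q ^ 2))"
    unfolding D_def qpoch_inf_even_odd[OF q(2), of "q / z ^ 2"] qpoch_inf_even_odd[OF q(2), of "z ^ 2"]
    using qpoch_inf_square[OF q(2), of "q / z"] qpoch_inf_square[OF q(2), of z]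
    by (simp add: power_divide power2_eq_square)
  ultimately show ?thesis
    using R0 by (simp add: R_def mult_ac)
qed

section \<open>The Bailey pair\<close>

lemma double_alpha_exp:
  "2 * alpha_exp_minus l r = (int l - 3) * (3 * (int r)^2 - int r)"
  "2 * alpha_exp_plus l r = (int l - 3) * (3 * (int r)^2 + int r)"
proof -
  have "even (3 * (int l - 3) * (int r)^2 - (int l - 3) * int r)"
    "even (3 * (int l - 3) * (int r)^2 + (int l - 3) * int r)" by simp_all
  then show "2 * alpha_exp_minus l r = (int l - 3) * (3 * (int r)^2 - int r)"
    "2 * alpha_exp_plus l r = (int l - 3) * (3 * (int r)^2 + int r)"
    unfolding alpha_exp_minus_def alpha_exp_plus_def by (simp_all add: algebra_simps)
qed

text \<open>Since \<open>l \<ge> 1\<close>, the exponents are at least \<open>-3r\<^sup>2 - r\<close>, which \<open>s\<^sup>2\<close> outweighs as \<open>r\<close> is about \<open>s/3\<close>.\<close>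

lemma alpha_exp_lower:
  assumes "l \<ge> 1" "3 * r \<le> s + 1"
  shows "int s - 3 \<le> alpha_exp_minus l r + int (s ^ 2)"
    and "int s - 3 \<le> alpha_exp_plus l r + int (s ^ 2)"
proof -
  have l: "-2 \<le> int l - 3" using assms by simp
  have r0: "0 \<le> 3 * (int r)^2 - int r" 
    by (cases r) (auto simp: power2_eq_square algebra_simps)
  have 1: "(-2) * (3 * (int r)^2 - int r) \<le> 2 * alpha_exp_minus l r"
    unfolding double_alpha_exp by (intro mult_right_mono l r0)
  have 2: "(-2) * (3 * (int r)^2 + int r) \<le> 2 * alpha_exp_plus l r"
    unfolding double_alpha_exp by (intro mult_right_mono l) simp
  have "(3 * int r) ^ 2 \<le> (int s + 1) ^ 2"
    using assms by (intro power_mono) auto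
  then have "9 * (int r)^2 \<le> (int s + 1) ^ 2" by (simp add: power_mult_distrib)
  \<comment> \<open>Inserting \<open>9 r^2 \<le> (s + 1)^2\<close> and
    \<open>3 r \<le> s + 1\<close> reduces the goal to \<open>0 \<le> 2 s^2 - 6 s + 7\<close>, and
    twice the right side is \<open>(2 s - 3)^2 + 5\<close>.\<close>
  moreover have "0 \<le> (2 * int s - 3) ^ 2" by simp
  ultimately have "int s - 3 \<le> - (3 * (int r)^2 + int r) + (int s) ^ 2"
    using assms(2) by (simp add: power2_eq_square algebra_simps)
  with 1 2 show "int s - 3 \<le> alpha_exp_minus l r + int (s ^ 2)"
    "int s - 3 \<le> alpha_exp_plus l r + int (s ^ 2)"
    by simp_all
qed

lemma norm_powi_bound:
  fixes q :: complex
  assumes "0 < norm q" "norm q < 1" "int s - 3 \<le> e + int (s ^ 2)"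
  shows "norm (q powi e) * norm q ^ (s ^ 2) \<le> norm q ^ s / norm q ^ 3"
proof -
  have "norm (q powi e) * norm q ^ (s ^ 2) = norm q powi (e + int (s ^ 2))"
    using assms by (simp add: norm_power_int power_int_add flip: power_int_of_nat)
  also have "\<dots> \<le> norm q powi (int s - 3)"
    using assms by (intro power_int_decreasing) auto
  also have "\<dots> = norm q ^ s / norm q ^ 3"
    using assms by (simp add: power_int_diff)
  finally show ?thesis .
qed

lemma alpha_summable:
  assumes "l \<ge> 1" "0 < norm q" "norm q < 1"
  shows "summable (\<lambda>s. norm (alpha l q s) * norm q ^ (s ^ 2))"
proof (rule summable_comparison_test')
  show "summable (\<lambda>s. 2 / norm q ^ 3 * norm q ^ s)"
    using assms by (intro summable_mult) simp
  fix s :: nat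
  define r where "r = (s + 1) div 3"
  have r: "3 * r \<le> s + 1" by (simp add: r_def)
  define B where "B = norm q ^ s / norm q ^ 3"
  note b = norm_powi_bound[OF assms(2,3) alpha_exp_lower(1)[OF assms(1) r], folded B_def]
     norm_powi_bound[OF assms(2,3) alpha_exp_lower(2)[OF assms(1) r], folded B_def]
  have B: "0 \<le> B" by (simp add: B_def)
  \<comment> \<open>The value \<open>alpha l q 0 = 1\<close> is set separately and is not one of the
    powers bounded by \<open>b\<close>.\<close>
  have one: "1 \<le> B" if "s = 0"
    using that assms by (simp add: B_def power_le_one)
  have "norm (q powi alpha_exp_minus l r + q powi alpha_exp_plus l r) * norm q ^ (s ^ 2) \<le> 2 * B"
    using mult_right_mono[OF norm_triangle_ineq, of "norm q ^ (s ^ 2)" "q powi alpha_exp_minus l r" "q powi alpha_exp_plus l r"] b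
    unfolding distrib_right by simp
  then have "norm (alpha l q s) * norm q ^ (s ^ 2) \<le> 2 * B"
    using b B one unfolding alpha_def Let_def r_def[symmetric] by auto
  then show "norm (norm (alpha l q s) * norm q ^ (s ^ 2)) \<le> 2 / norm q ^ 3 * norm q ^ s"
    by (simp add: B_def)
qed

text \<open>Writing \<open>l + 3 = (l - 3) + 6\<close> splits the exponent
  \<open>(l + 3)(3 m^2 + m)/2\<close> into an \<open>alpha\<close> exponent and a completed square.
  The term at \<open>m\<close> carries one half of \<open>alpha\<close> at \<open>3m\<close> and all
  of \<open>alpha\<close> at \<open>3m + 1\<close>; the term at \<open>-m\<close> carries the other
  half and \<open>alpha\<close> at \<open>3m - 1\<close>, each with its weight
  \<open>q^(s^2)\<close>.\<close>

lemma quint_terms_powi: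
  fixes q :: complex and l m :: nat
  assumes q: "q \<noteq> 0"
  shows "quint_pos (q ^ (l + 3)) (- q) m
      = q powi (9 * int m ^ 2 + alpha_exp_minus l m) - q powi (9 * int m ^ 2 + alpha_exp_plus l m + 6 * int m + 1)"
    and "quint_neg (q ^ (l + 3)) (- q) m
      = q powi (9 * int m ^ 2 + alpha_exp_plus l m) - q powi (9 * int m ^ 2 + alpha_exp_minus l m - 6 * int m + 1)"
proof -
  define Q where "Q = q ^ (l + 3)"
  define t where "t = m ^ 2 + triangle m"
  have Q: "Q ^ n = q powi (int (l + 3) * int n)" for n
    by (simp add: Q_def power_int_mult flip: power_int_of_nat)
  have comb: "q powi a * q powi b = q powi (a + b)" "q powi a / q powi b = q powi (a - b)" for a b
    using q by (simp_all add: power_int_add power_int_diff)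
  have P3: "q powi (3 * int m) = q ^ (3 * m)"
    using power_int_of_nat[of q "3 * m"] by simp
  have Q0: "Q \<noteq> 0" using q by (simp add: Q_def)
  have t: "2 * int t = 3 * int m ^ 2 + int m"
    using arg_cong[OF triangle_double[of m], of int] by (simp add: t_def power2_eq_square algebra_simps)
  have "2 * (int (l + 3) * int t) = (int l + 3) * (3 * int m ^ 2 + int m)"
    by (simp flip: t)
  \<comment> \<open>Two readings of one exponent: the second serves the terms divided by
    \<open>Q ^ m\<close>, whose exponent \<open>(l + 3) m\<close> it displays for
    cancellation.\<close>
  then have e: "int (l + 3) * int t = 9 * int m ^ 2 + alpha_exp_plus l m + 3 * int m"
    "int (l + 3) * int t = 9 * int m ^ 2 + alpha_exp_minus l m - 3 * int m + int (l + 3) * int m"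
    using double_alpha_exp[of l m] by (simp_all add: algebra_simps)
  \<comment> \<open>As 3 is odd, the choice \<open>z = -q\<close> cancels the alternating sign of
    the bilateral series.\<close>
  have "(- 1) ^ m * (- q) ^ (3 * m) = (q ^ (3 * m) :: complex)"
    by (simp add: power_minus[of q] power_mult flip: power_mult_distrib)
  then have "quint_pos Q (- q) m = (1 - q * Q ^ m) * q ^ (3 * m) * Q ^ t / Q ^ m"
    unfolding quint_pos_def t_def by (simp add: mult_ac)
  also have "\<dots> = q powi (3 * int m) * q powi (int (l + 3) * int t) / q powi (int (l + 3) * int m)
      - q powi 1 * q powi (3 * int m) * q powi (int (l + 3) * int t)"
    unfolding Q[symmetric] P3 power_int_1_right using q Q0 by (simp add: field_simps)
  also have "q powi (3 * int m) * q powi (int (l + 3) * int t) / q powi (int (l + 3) * int m)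
      = q powi (9 * int m ^ 2 + alpha_exp_minus l m)"
    unfolding e(2) comb by (rule arg_cong[of _ _ "(powi) q"]) (simp add: algebra_simps)
  also have "q powi 1 * q powi (3 * int m) * q powi (int (l + 3) * int t)
      = q powi (9 * int m ^ 2 + alpha_exp_plus l m + 6 * int m + 1)"
    unfolding e(1) comb by (rule arg_cong[of _ _ "(powi) q"]) (simp add: algebra_simps)
  finally show "quint_pos (q ^ (l + 3)) (- q) m
      = q powi (9 * int m ^ 2 + alpha_exp_minus l m) - q powi (9 * int m ^ 2 + alpha_exp_plus l m + 6 * int m + 1)"
    unfolding Q_def .
  have "(- q) ^ (3 * m) = (- 1) ^ m * q ^ (3 * m)"
    by (simp add: power_minus[of q] power_mult flip: power_mult_distrib)
  then have "quint_neg Q (- q) m = (1 - q / Q ^ m) * Q ^ t / q ^ (3 * m)"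
    unfolding quint_neg_def t_def by simp
  also have "\<dots> = q powi (int (l + 3) * int t) / q powi (3 * int m)
      - q powi 1 * q powi (int (l + 3) * int t) / q powi (int (l + 3) * int m) / q powi (3 * int m)"
    unfolding Q[symmetric] P3 power_int_1_right using q Q0 by (simp add: field_simps)
  also have "q powi (int (l + 3) * int t) / q powi (3 * int m) = q powi (9 * int m ^ 2 + alpha_exp_plus l m)"
    unfolding e(1) comb by (rule arg_cong[of _ _ "(powi) q"]) (simp add: algebra_simps)
  also have "q powi 1 * q powi (int (l + 3) * int t) / q powi (int (l + 3) * int m) / q powi (3 * int m)
      = q powi (9 * int m ^ 2 + alpha_exp_minus l m - 6 * int m + 1)"
    unfolding e(2) comb by (rule arg_cong[of _ _ "(powi) q"]) (simp add: algebra_simps)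
  finally show "quint_neg (q ^ (l + 3)) (- q) m
      = q powi (9 * int m ^ 2 + alpha_exp_plus l m) - q powi (9 * int m ^ 2 + alpha_exp_minus l m - 6 * int m + 1)"
    unfolding Q_def .
qed

text \<open>For \<open>m \<ge> 1\<close> the group around \<open>3m\<close> is the pair of bilateral
  terms at \<open>m\<close> and \<open>-m\<close>. The group \<open>m = 0\<close> is
  \<open>1 - q\<close>, the central term \<open>1 + z\<close> at \<open>z = -q\<close>.\<close>

lemma alpha_sum:
  assumes "l \<ge> 1" "0 < norm q" "norm q < 1"
  shows "(\<Sum>s. alpha l q s * q ^ (s ^ 2))
    = qpochs_inf [q, q ^ (l + 2), q ^ (l + 3)] (q ^ (l + 3)) * qpochs_inf [q ^ (l + 1), q ^ (l + 5)] (q ^ (2 * l + 6))"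
    (is "?A = ?P")
proof -
  define Q where "Q = q ^ (l + 3)"
  define f where "f s = alpha l q s * q ^ (s ^ 2)" for s
  have q: "q \<noteq> 0" using assms by auto
  have Q: "Q \<noteq> 0" "norm Q < 1"
    using assms by (auto simp: Q_def norm_power power_less_one_iff)
  \<comment> \<open>Equality would force \<open>l + 3\<close> to divide 2, since powers of
    \<open>norm q\<close> determine their exponents.\<close>
  have generic: "(- q) ^ 2 * Q ^ i \<noteq> Q ^ j" for i j
  proof
    assume "(- q) ^ 2 * Q ^ i = Q ^ j"
    moreover have "q ^ (2 + (l + 3) * i) = (- q) ^ 2 * Q ^ i" "q ^ ((l + 3) * j) = Q ^ j"
      by (simp_all only: Q_def power_add power_mult power2_minus)
    ultimately have "norm (q ^ (2 + (l + 3) * i)) = norm (q ^ ((l + 3) * j))"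
      by simp
    then have "norm q ^ (2 + (l + 3) * i) = norm q ^ ((l + 3) * j)"
      by (simp only: norm_power)
    then have "2 + (l + 3) * i = (l + 3) * j"
      using assms power_strict_decreasing_iff[of "norm q"] by (metis linorder_neq_iff)
    then have "(l + 3) dvd 2 + (l + 3) * i" by simp
    then have "(l + 3) dvd 2" by (simp only: dvd_add_left_iff dvd_triv_left)
    then show False by (auto dest: dvd_imp_le)
  qed
  have "summable f"
    by (rule summable_norm_cancel) (use alpha_summable[OF assms] in \<open>simp add: f_def norm_mult norm_power\<close>)
  define h where "h m = (if m = 0 then 0 else f (3 * m - 1)) + f (3 * m) + f (3 * m + 1)" for m
  have "h sums ?A"
    unfolding h_def f_def[symmetric] by (intro sums_group_by_3 summable_sums \<open>summable f\<close>)
  then have "h sums (?A - (f 0 + f 1) + h 0)" by (simp add: h_def)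
  then have "(\<lambda>m. h (Suc m)) sums (?A - (f 0 + f 1))" by (simp only: sums_Suc_iff)
  moreover have "h (Suc m) = quint_pos Q (- q) (Suc m) + quint_neg Q (- q) (Suc m)" for m
  proof -
    define M where "M = Suc m"
    have "M \<ge> 1" by (simp add: M_def)
    have sq: "int ((3 * M - 1) ^ 2) = 9 * int M ^ 2 - 6 * int M + 1"
      "int ((3 * M) ^ 2) = 9 * int M ^ 2" "int ((3 * M + 1) ^ 2) = 9 * int M ^ 2 + 6 * int M + 1"
      by (simp_all add: M_def power2_eq_square algebra_simps)
    have p: "q powi e * q ^ n = q powi (e + int n)" for e n
      using q by (simp add: power_int_add)
    have "h M = f (3 * M - 1) + f (3 * M) + f (3 * M + 1)"
      using \<open>M \<ge> 1\<close> by (simp add: h_def)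
    then show ?thesis
      unfolding M_def[symmetric] f_def Q_def alpha_3r[OF \<open>M \<ge> 1\<close>] alpha_3r_minus_1[OF \<open>M \<ge> 1\<close>]
        alpha_3r_plus_1 quint_terms_powi[OF q] distrib_right mult_minus_left p sq
      by (simp add: algebra_simps)
  qed
  ultimately have "(\<lambda>m. quint_pos Q (- q) (Suc m) + quint_neg Q (- q) (Suc m)) sums (?A - (f 0 + f 1))"
    by simp
  from sums_unique2[OF this quintuple_product[OF Q _ generic]] 
  have "?A - (f 0 + f 1) = qpoch_inf Q Q * qpoch_inf q Q * qpoch_inf (Q / q) Q
      * qpoch_inf (q ^ 2 * Q) (Q ^ 2) * qpoch_inf (Q / q ^ 2) (Q ^ 2) - (1 - q)"
    using q by simp
  moreover have "f 0 + f 1 = 1 - q"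
    using alpha_3r_plus_1[of l q 0] by (simp add: f_def alpha_0 alpha_exp_plus_def)
  moreover have "Q / q = q ^ (l + 2)" "q ^ 2 * Q = q ^ (l + 5)" "Q / q ^ 2 = q ^ (l + 1)" "Q ^ 2 = q ^ (2 * l + 6)"
    using q by (simp_all add: Q_def power_add power_mult eval_nat_numeral power_mult_distrib mult_2)
  ultimately show ?thesis
    by (simp add: qpochs_inf_def Q_def[symmetric] mult_ac)
qed

theorem mainTheorem2:
  fixes l :: nat and q :: complex
  assumes "l \<ge> 1" and "0 < norm q" and "norm q < 1"
  shows "(\<lambda>m::nat. q ^ (9 * m^2) *
            (q powi (- 6 * int m + 1) * beta l q (3 * int m - 1)
             + beta l q (3 * int m)
             + q ^ (6 * m + 1) * beta l q (3 * int m + 1)))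
         sums
         (qpochs_inf [q, q ^ (l + 2), q ^ (l + 3)] (q ^ (l + 3))
          * qpochs_inf [q ^ (l + 1), q ^ (l + 5)] (q ^ (2 * l + 6))
          / qpoch_inf q q)"
proof -
  define g where "g n = q ^ (n ^ 2) * beta l q (int n)" for n
  have q: "q \<noteq> 0" using assms by auto
  have "g sums ((\<Sum>s. alpha l q s * q ^ (s ^ 2)) / qpoch_inf q q)"
    unfolding g_def beta_def using bailey_limit[OF assms(3) alpha_summable[OF assms]] by simp
  from sums_group_by_3[OF this]
  have "(\<lambda>m. (if m = 0 then 0 else g (3 * m - 1)) + g (3 * m) + g (3 * m + 1)) sums
         (qpochs_inf [q, q ^ (l + 2), q ^ (l + 3)] (q ^ (l + 3))
          * qpochs_inf [q ^ (l + 1), q ^ (l + 5)] (q ^ (2 * l + 6))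
          / qpoch_inf q q)"
    unfolding alpha_sum[OF assms] .
  moreover have "(if m = 0 then 0 else g (3 * m - 1)) + g (3 * m) + g (3 * m + 1)
    = q ^ (9 * m^2) *
            (q powi (- 6 * int m + 1) * beta l q (3 * int m - 1)
             + beta l q (3 * int m)
             + q ^ (6 * m + 1) * beta l q (3 * int m + 1))" for m
  proof -
    \<comment> \<open>At \<open>m = 0\<close> both sides vanish because \<open>beta\<close> is 0 at
      -1. Otherwise \<open>(3m-1)^2 = 9 m^2 - 6 m + 1\<close> is split over the integers, as
      \<open>- 6 m + 1\<close> is negative.\<close>
    have "(if m = 0 then 0 else g (3 * m - 1)) = q ^ (9 * m^2) * (q powi (- 6 * int m + 1) * beta l q (3 * int m - 1))"
    proof (cases "m = 0")
      case False
      then have m: "int (3 * m - 1) = 3 * int m - 1" by simp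
      have "int ((3 * m - 1) ^ 2) = int (9 * m ^ 2) + (- 6 * int m + 1)"
        unfolding of_nat_power m by (simp add: power2_eq_square algebra_simps)
      then have "q ^ ((3 * m - 1) ^ 2) = q ^ (9 * m ^ 2) * q powi (- 6 * int m + 1)"
        using q by (metis power_int_add power_int_of_nat)
      then show ?thesis using False by (simp add: g_def m mult.assoc)
    qed (simp add: beta_def)
    moreover have "(3 * m) ^ 2 = 9 * m ^ 2" "(3 * m + 1) ^ 2 = 9 * m ^ 2 + (6 * m + 1)"
      by (simp_all add: power2_eq_square algebra_simps)
    ultimately show ?thesis
      unfolding distrib_left by (simp add: g_def power_add add.commute[of 1])
  qed
  ultimately show ?thesis by simp
qed

end
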